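(* Let $\mathcal{D}=\langle A_0;S_0;T_0;\theta_0\rangle\Longrightarrow^{*}\langle\emptyset;S_n;T_n;\theta_n\rangle$ be an $\textsc{AUnif}$ derivation to a final configuration, and let $\sigma_{\mathcal{D}}=\sigma_{S_n\cup T_n}$ and $\rho_{\mathcal{D}}=\rho_{S_n\cup T_n}$. Then for every $s\triangleq_x t\in A_0\cup S_0\cup T_0$ we have $x\theta_n\in\mathcal{G}_{\mathtt{Abs}}(s,t)$, with $x\theta_n\sigma_{\mathcal{D}}\approx_{\mathtt{Abs}}s$ and $x\theta_n\rho_{\mathcal{D}}\approx_{\mathtt{Abs}}t$.
   Context: Terms are built over variables $\mathcal{V}$ and function symbols $\mathcal{F}$ containing a special constant $\star$ (wild card); $head(x)=x$, $head(f(t_1,\dots,t_n))=f$. Substitutions are postfix; $\mathit{Dom}(\sigma)=\{x\mid x\sigma\neq x\}$; $\mathit{Rvar}(\sigma)$ is the set of variables in its range. An absorption theory $\mathtt{Abs}$ is a finite union of axiom sets $\{f(x,\varepsilon_f)\approx\varepsilon_f, f(\varepsilon_f,x)\approx\varepsilon_f\}$ for pairwise distinct binary $f$; $f,\varepsilon_f$ are related absorption symbols; $\approx_{\mathtt{Abs}}$ is the induced equality. $r\preceq_{\mathtt{Abs}}s$ iff $r\sigma\approx_{\mathtt{Abs}}s$ for some $\sigma$; $\mathcal{G}_{\mathtt{Abs}}(s,t)=\{r\mid r\preceq_{\mathtt{Abs}}s,\ r\preceq_{\mathtt{Abs}}t\}$. A term is in $\mathtt{Abs}$-normal form if no $\varepsilon_f$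 occurs as an argument of $f$. An AUE is $s\triangleq_x t$ with label $x$; a set of AUEs is valid if labels are pairwise distinct; an AUE is wild if a side is $\star$; solved if $head(s)\neq head(t)$, they are not related absorption symbols, and it is not wild. A configuration $\langle A;S;T;\theta\rangle$: $A$ valid set of AUEs, $S$ valid set of solved AUEs, $T$ valid set of wild AUEs, $\theta$ a substitution, all terms in $\mathtt{Abs}$-normal form, $labels(A),labels(S),labels(T),\mathit{Dom}(\theta)$ pairwise disjoint, $\mathit{Rvar}(\theta)=labels(A)\cup labels(S)\cup labels(T)$. Rules of $\textsc{AUnif}$ ($\uplus$ disjoint union; $y_i$ fresh; $f$ in Exp rules an absorption symbol): (Dec) $\langle\{f(s_1,\dots,s_n)\triangleq_x f(t_1,\dots,t_n)\}\uplus A;S;T;\theta\rangle\Longrightarrow\langle\{s_i\triangleq_{y_i}t_i\}_{i=1}^n\cup A;S;T;\theta\{x\mapsto f(y_1,\dots,y_n)\}\rangle$, $n\ge0$. (Sol) $\langle\{s\triangleq_x t\}\uplus A;S;T;\theta\rangle\Longrightarrow\langle A;\{s\triangleq_x t\}\cup S;T;\theta\rangle$ if $head(s)\neq head(t)$ and they are not related absorption symbols. (ExpLA1) $\langle\{\varepsilon_f\triangleq_x f(t_1,t_2)\}\uplus A;S;T;\theta\rangle\Longrightarrow\langle\{\varepsilon_f\triangleq_{y_1}t_1\}\cup A;S;\{\star\triangleq_{y_2}t_2\}\cup T;\theta\{x\mapsto f(y_1,y_2)\}\rangle$. (ExpLA2) same left side $\Longrightarrow\langle\{\varepsilon_f\triangleq_{y_2}t_2\}\cup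 A;S;\{\star\triangleq_{y_1}t_1\}\cup T;\theta\{x\mapsto f(y_1,y_2)\}\rangle$. (ExpRA1) $\langle\{f(s_1,s_2)\triangleq_x\varepsilon_f\}\uplus A;S;T;\theta\rangle\Longrightarrow\langle\{s_1\triangleq_{y_1}\varepsilon_f\}\cup A;S;\{s_2\triangleq_{y_2}\star\}\cup T;\theta\{x\mapsto f(y_1,y_2)\}\rangle$. (ExpRA2) same left side $\Longrightarrow\langle\{s_2\triangleq_{y_2}\varepsilon_f\}\cup A;S;\{s_1\triangleq_{y_1}\star\}\cup T;\theta\{x\mapsto f(y_1,y_2)\}\rangle$. (Mer) $\langle\emptyset;\{s\triangleq_x t,s\triangleq_y t\}\cup S;T;\theta\rangle\Longrightarrow\langle\emptyset;\{s\triangleq_y t\}\cup S;T;\theta\{x\mapsto y\}\rangle$. A final configuration is one reached by a finite derivation to which no rule applies. For a valid set $W$ of AUEs, $\sigma_W=\{y\mapsto s\mid s\triangleq_y t\in W\}$ and $\rho_W=\{y\mapsto t\mid s\triangleq_y t\in W\}$. In the equalities, the wild card $\star$ is treated as an ordinary constant occurring under an absorption symbol next to $\varepsilon_f$ where it is absorbed. *)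

theory Defs
  imports Main
begin

section \<open>Terms and substitutions\<close>

datatype ('f, 'v) trm = Var 'v | Fun 'f "('f, 'v) trm list"

type_synonym ('f, 'v) subst = "'v \<Rightarrow> ('f, 'v) trm"

fun vars :: "('f, 'v) trm \<Rightarrow> 'v set" where
  "vars (Var x) = {x}"
| "vars (Fun f ts) = (\<Union>t\<in>set ts. vars t)"

text \<open>The symbols of the signature are the elements of the type \<open>'f\<close>, with arities given by \<open>ar\<close>;
  the terms over the signature are the arity-respecting elements of the datatype.\<close>

fun wf_trm :: "('f \<Rightarrow> nat) \<Rightarrow> ('f, 'v) trm \<Rightarrow> bool" where
  "wf_trm ar (Var x) \<longleftrightarrow> True"
| "wf_trm ar (Fun f ts) \<longleftrightarrow> length ts = ar f \<and> (\<forall>t\<in>set ts. wf_trm ar t)"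

primrec head :: "('f, 'v) trm \<Rightarrow> 'v + 'f" where
  "head (Var x) = Inl x"
| "head (Fun f ts) = Inr f"

primrec subst_apply :: "('f, 'v) trm \<Rightarrow> ('f, 'v) subst \<Rightarrow> ('f, 'v) trm" (infixl "\<cdot>" 67) where
  "Var x \<cdot> \<sigma> = \<sigma> x"
| "Fun f ts \<cdot> \<sigma> = Fun f (map (\<lambda>t. t \<cdot> \<sigma>) ts)"

text \<open>Composition in postfix order: first \<open>\<sigma>\<close>, then \<open>\<tau>\<close>.\<close>

definition subst_comp :: "('f, 'v) subst \<Rightarrow> ('f, 'v) subst \<Rightarrow> ('f, 'v) subst" (infixl "\<circ>\<^sub>s" 75) where
  "\<sigma> \<circ>\<^sub>s \<tau> = (\<lambda>x. \<sigma> x \<cdot> \<tau>)"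

definition Dom :: "('f, 'v) subst \<Rightarrow> 'v set" where
  "Dom \<sigma> = {x. \<sigma> x \<noteq> Var x}"

definition Rvar :: "('f, 'v) subst \<Rightarrow> 'v set" where
  "Rvar \<sigma> = (\<Union>x\<in>Dom \<sigma>. vars (\<sigma> x))"

text \<open>Finiteness of the domain is not required; for the generalization preorder below this makes
  no difference (lemma \<open>more_general_finite_Dom\<close>).\<close>

definition wf_subst :: "('f \<Rightarrow> nat) \<Rightarrow> ('f, 'v) subst \<Rightarrow> bool" where
  "wf_subst ar \<sigma> \<longleftrightarrow> (\<forall>x. wf_trm ar (\<sigma> x))"


section \<open>Equational theories and absorption\<close>

inductive eq_theory ::
  "('f \<Rightarrow> nat) \<Rightarrow> (('f, 'v) trm \<times> ('f, 'v) trm) set \<Rightarrow> ('f, 'v) trm \<Rightarrow> ('f, 'v) trm \<Rightarrow> bool"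
  for ar E where
  ax: "(l, r) \<in> E \<Longrightarrow> wf_subst ar \<sigma> \<Longrightarrow> eq_theory ar E (l \<cdot> \<sigma>) (r \<cdot> \<sigma>)"
| refl: "wf_trm ar t \<Longrightarrow> eq_theory ar E t t"
| sym: "eq_theory ar E s t \<Longrightarrow> eq_theory ar E t s"
| trans: "eq_theory ar E s t \<Longrightarrow> eq_theory ar E t u \<Longrightarrow> eq_theory ar E s u"
| cong: "list_all2 (eq_theory ar E) ss ts \<Longrightarrow> length ss = ar f \<Longrightarrow>
    eq_theory ar E (Fun f ss) (Fun f ts)"

text \<open>An absorption theory is given by a finite partial map \<open>ab\<close> with \<open>ab f = Some e\<close> iff \<open>f\<close> is
  an absorption symbol with \<open>\<epsilon>\<^sub>f = e\<close>.\<close>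

definition absorption_theory :: "('f \<Rightarrow> nat) \<Rightarrow> ('f \<rightharpoonup> 'f) \<Rightarrow> bool" where
  "absorption_theory ar ab \<longleftrightarrow>
     finite (dom ab) \<and> (\<forall>f e. ab f = Some e \<longrightarrow> ar f = 2 \<and> ar e = 0)"

definition Abs_axioms :: "('f \<rightharpoonup> 'f) \<Rightarrow> (('f, 'v) trm \<times> ('f, 'v) trm) set" where
  "Abs_axioms ab =
     {(Fun f [Var x, Fun e []], Fun e []) | f e x. ab f = Some e} \<union>
     {(Fun f [Fun e [], Var x], Fun e []) | f e x. ab f = Some e}"

definition abs_eq ::
  "('f \<Rightarrow> nat) \<Rightarrow> ('f \<rightharpoonup> 'f) \<Rightarrow> ('f, 'v) trm \<Rightarrow> ('f, 'v) trm \<Rightarrow> bool" where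
  "abs_eq ar ab = eq_theory ar (Abs_axioms ab)"

definition related :: "('f \<rightharpoonup> 'f) \<Rightarrow> 'v + 'f \<Rightarrow> 'v + 'f \<Rightarrow> bool" where
  "related ab h k \<longleftrightarrow>
     (\<exists>f e. ab f = Some e \<and> (h = Inr f \<and> k = Inr e \<or> h = Inr e \<and> k = Inr f))"

fun abs_nf :: "('f \<rightharpoonup> 'f) \<Rightarrow> ('f, 'v) trm \<Rightarrow> bool" where
  "abs_nf ab (Var x) \<longleftrightarrow> True"
| "abs_nf ab (Fun f ts) \<longleftrightarrow>
     (\<forall>e. ab f = Some e \<longrightarrow> Fun e [] \<notin> set ts) \<and> (\<forall>t\<in>set ts. abs_nf ab t)"

definition more_general ::
  "('f \<Rightarrow> nat) \<Rightarrow> ('f \<rightharpoonup> 'f) \<Rightarrow> ('f, 'v) trm \<Rightarrow> ('f, 'v) trm \<Rightarrow> bool" where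
  "more_general ar ab r s \<longleftrightarrow> (\<exists>\<sigma>. wf_subst ar \<sigma> \<and> abs_eq ar ab (r \<cdot> \<sigma>) s)"

definition generalizations ::
  "('f \<Rightarrow> nat) \<Rightarrow> ('f \<rightharpoonup> 'f) \<Rightarrow> ('f, 'v) trm \<Rightarrow> ('f, 'v) trm \<Rightarrow> ('f, 'v) trm set" where
  "generalizations ar ab s t =
     {r. wf_trm ar r \<and> more_general ar ab r s \<and> more_general ar ab r t}"

lemma finite_vars: "finite (vars t)"
  by (induction t) auto

lemma subst_apply_cong: "(\<And>x. x \<in> vars t \<Longrightarrow> \<sigma> x = \<tau> x) \<Longrightarrow> t \<cdot> \<sigma> = t \<cdot> \<tau>"
  by (induction t) auto

lemma more_general_finite_Dom:
  "more_general ar ab r s \<longleftrightarrow>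
     (\<exists>\<sigma>. wf_subst ar \<sigma> \<and> finite (Dom \<sigma>) \<and> abs_eq ar ab (r \<cdot> \<sigma>) s)"
proof
  assume "more_general ar ab r s"
  then obtain \<sigma> where \<sigma>: "wf_subst ar \<sigma>" "abs_eq ar ab (r \<cdot> \<sigma>) s"
    by (auto simp: more_general_def)
  define \<tau> where "\<tau> = (\<lambda>x. if x \<in> vars r then \<sigma> x else Var x)"
  have "r \<cdot> \<tau> = r \<cdot> \<sigma>"
    by (rule subst_apply_cong) (simp add: \<tau>_def)
  moreover have "wf_subst ar \<tau>"
    using \<sigma>(1) by (simp add: wf_subst_def \<tau>_def)
  moreover have "Dom \<tau> \<subseteq> vars r"
    by (auto simp: Dom_def \<tau>_def)
  then have "finite (Dom \<tau>)"
    using finite_vars finite_subset by blast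
  ultimately show "\<exists>\<sigma>. wf_subst ar \<sigma> \<and> finite (Dom \<sigma>) \<and> abs_eq ar ab (r \<cdot> \<sigma>) s"
    using \<sigma>(2) by metis
qed (auto simp: more_general_def)


section \<open>Anti-unification equations and configurations\<close>

datatype ('f, 'v) aue =
  AUE (lhs: "('f, 'v) trm") (label: 'v) (rhs: "('f, 'v) trm")  ("_ \<triangleq>\<^bsub>_\<^esub> _" [61, 0, 61] 60)

abbreviation labels :: "('f, 'v) aue set \<Rightarrow> 'v set" where
  "labels W \<equiv> label ` W"

definition valid :: "('f, 'v) aue set \<Rightarrow> bool" where
  "valid W \<longleftrightarrow> inj_on label W"

definition wild :: "'f \<Rightarrow> ('f, 'v) aue \<Rightarrow> bool" where
  "wild star u \<longleftrightarrow> lhs u = Fun star [] \<or> rhs u = Fun star []"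

definition solved :: "('f \<rightharpoonup> 'f) \<Rightarrow> 'f \<Rightarrow> ('f, 'v) aue \<Rightarrow> bool" where
  "solved ab star u \<longleftrightarrow>
     head (lhs u) \<noteq> head (rhs u) \<and> \<not> related ab (head (lhs u)) (head (rhs u)) \<and> \<not> wild star u"

type_synonym ('f, 'v) config =
  "('f, 'v) aue set \<times> ('f, 'v) aue set \<times> ('f, 'v) aue set \<times> ('f, 'v) subst"

fun configuration :: "('f \<Rightarrow> nat) \<Rightarrow> ('f \<rightharpoonup> 'f) \<Rightarrow> 'f \<Rightarrow> ('f, 'v) config \<Rightarrow> bool" where
  "configuration ar ab star (A, S, T, \<theta>) \<longleftrightarrow>
     valid A \<and>
     valid S \<and> (\<forall>u\<in>S. solved ab star u) \<and>
     valid T \<and> (\<forall>u\<in>T. wild star u) \<and>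
     (\<forall>u\<in>A \<union> S \<union> T. wf_trm ar (lhs u) \<and> wf_trm ar (rhs u) \<and>
        abs_nf ab (lhs u) \<and> abs_nf ab (rhs u)) \<and>
     wf_subst ar \<theta> \<and> (\<forall>x. abs_nf ab (\<theta> x)) \<and>
     labels A \<inter> labels S = {} \<and> labels A \<inter> labels T = {} \<and> labels S \<inter> labels T = {} \<and>
     labels A \<inter> Dom \<theta> = {} \<and> labels S \<inter> Dom \<theta> = {} \<and> labels T \<inter> Dom \<theta> = {} \<and>
     Rvar \<theta> = labels A \<union> labels S \<union> labels T"

fun config_vars :: "('f, 'v) config \<Rightarrow> 'v set" where
  "config_vars (A, S, T, \<theta>) =
     labels (A \<union> S \<union> T) \<union> (\<Union>u\<in>A \<union> S \<union> T. vars (lhs u) \<union> vars (rhs u)) \<union> Dom \<theta> \<union> Rvar \<theta>"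

definition fresh :: "'v list \<Rightarrow> ('f, 'v) config \<Rightarrow> bool" where
  "fresh ys c \<longleftrightarrow> distinct ys \<and> set ys \<inter> config_vars c = {}"


section \<open>The rules\<close>

text \<open>A disjoint union \<open>{u} \<uplus> A\<close> on the left of a rule is rendered as \<open>insert u A\<close> with \<open>u \<notin> A\<close>.\<close>

inductive step :: "('f \<rightharpoonup> 'f) \<Rightarrow> 'f \<Rightarrow> ('f, 'v) config \<Rightarrow> ('f, 'v) config \<Rightarrow> bool"
  for ab star where
  Dec: "\<lbrakk> (Fun f ss \<triangleq>\<^bsub>x\<^esub> Fun f ts) \<notin> A; length ss = n; length ts = n; length ys = n;
      fresh ys (insert (Fun f ss \<triangleq>\<^bsub>x\<^esub> Fun f ts) A, S, T, \<theta>) \<rbrakk> \<Longrightarrow>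
    step ab star (insert (Fun f ss \<triangleq>\<^bsub>x\<^esub> Fun f ts) A, S, T, \<theta>)
      ({(ss ! i \<triangleq>\<^bsub>ys ! i\<^esub> ts ! i) | i. i < n} \<union> A, S, T, \<theta> \<circ>\<^sub>s Var(x := Fun f (map Var ys)))"
| Sol: "\<lbrakk> (s \<triangleq>\<^bsub>x\<^esub> t) \<notin> A; head s \<noteq> head t; \<not> related ab (head s) (head t) \<rbrakk> \<Longrightarrow>
    step ab star (insert (s \<triangleq>\<^bsub>x\<^esub> t) A, S, T, \<theta>) (A, insert (s \<triangleq>\<^bsub>x\<^esub> t) S, T, \<theta>)"
| ExpLA1: "\<lbrakk> (Fun e [] \<triangleq>\<^bsub>x\<^esub> Fun f [t1, t2]) \<notin> A; ab f = Some e;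
      fresh [y1, y2] (insert (Fun e [] \<triangleq>\<^bsub>x\<^esub> Fun f [t1, t2]) A, S, T, \<theta>) \<rbrakk> \<Longrightarrow>
    step ab star (insert (Fun e [] \<triangleq>\<^bsub>x\<^esub> Fun f [t1, t2]) A, S, T, \<theta>)
      (insert (Fun e [] \<triangleq>\<^bsub>y1\<^esub> t1) A, S, insert (Fun star [] \<triangleq>\<^bsub>y2\<^esub> t2) T,
       \<theta> \<circ>\<^sub>s Var(x := Fun f [Var y1, Var y2]))"
| ExpLA2: "\<lbrakk> (Fun e [] \<triangleq>\<^bsub>x\<^esub> Fun f [t1, t2]) \<notin> A; ab f = Some e;
      fresh [y1, y2] (insert (Fun e [] \<triangleq>\<^bsub>x\<^esub> Fun f [t1, t2]) A, S, T, \<theta>) \<rbrakk> \<Longrightarrow>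
    step ab star (insert (Fun e [] \<triangleq>\<^bsub>x\<^esub> Fun f [t1, t2]) A, S, T, \<theta>)
      (insert (Fun e [] \<triangleq>\<^bsub>y2\<^esub> t2) A, S, insert (Fun star [] \<triangleq>\<^bsub>y1\<^esub> t1) T,
       \<theta> \<circ>\<^sub>s Var(x := Fun f [Var y1, Var y2]))"
| ExpRA1: "\<lbrakk> (Fun f [s1, s2] \<triangleq>\<^bsub>x\<^esub> Fun e []) \<notin> A; ab f = Some e;
      fresh [y1, y2] (insert (Fun f [s1, s2] \<triangleq>\<^bsub>x\<^esub> Fun e []) A, S, T, \<theta>) \<rbrakk> \<Longrightarrow>
    step ab star (insert (Fun f [s1, s2] \<triangleq>\<^bsub>x\<^esub> Fun e []) A, S, T, \<theta>)
      (insert (s1 \<triangleq>\<^bsub>y1\<^esub> Fun e []) A, S, insert (s2 \<triangleq>\<^bsub>y2\<^esub> Fun star []) T,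
       \<theta> \<circ>\<^sub>s Var(x := Fun f [Var y1, Var y2]))"
| ExpRA2: "\<lbrakk> (Fun f [s1, s2] \<triangleq>\<^bsub>x\<^esub> Fun e []) \<notin> A; ab f = Some e;
      fresh [y1, y2] (insert (Fun f [s1, s2] \<triangleq>\<^bsub>x\<^esub> Fun e []) A, S, T, \<theta>) \<rbrakk> \<Longrightarrow>
    step ab star (insert (Fun f [s1, s2] \<triangleq>\<^bsub>x\<^esub> Fun e []) A, S, T, \<theta>)
      (insert (s2 \<triangleq>\<^bsub>y2\<^esub> Fun e []) A, S, insert (s1 \<triangleq>\<^bsub>y1\<^esub> Fun star []) T,
       \<theta> \<circ>\<^sub>s Var(x := Fun f [Var y1, Var y2]))"
| Mer: "\<lbrakk> x \<noteq> y; (s \<triangleq>\<^bsub>x\<^esub> t) \<notin> S; (s \<triangleq>\<^bsub>y\<^esub> t) \<notin> S \<rbrakk> \<Longrightarrow>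
    step ab star ({}, {s \<triangleq>\<^bsub>x\<^esub> t, s \<triangleq>\<^bsub>y\<^esub> t} \<union> S, T, \<theta>)
      ({}, {s \<triangleq>\<^bsub>y\<^esub> t} \<union> S, T, \<theta> \<circ>\<^sub>s Var(x := Var y))"

definition derivation ::
  "('f \<Rightarrow> nat) \<Rightarrow> ('f \<rightharpoonup> 'f) \<Rightarrow> 'f \<Rightarrow> ('f, 'v) config \<Rightarrow> ('f, 'v) config \<Rightarrow> bool" where
  "derivation ar ab star c c' \<longleftrightarrow> configuration ar ab star c \<and> (step ab star)\<^sup>*\<^sup>* c c'"

definition final :: "('f \<rightharpoonup> 'f) \<Rightarrow> 'f \<Rightarrow> ('f, 'v) config \<Rightarrow> bool" where
  "final ab star c \<longleftrightarrow> (\<nexists>c'. step ab star c c')"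

text \<open>The next two definitions are meaningful for valid \<open>W\<close>, where the equation with label \<open>y\<close> is
  unique.\<close>

definition lhs_subst :: "('f, 'v) aue set \<Rightarrow> ('f, 'v) subst" where
  "lhs_subst W = (\<lambda>y. if y \<in> labels W then lhs (THE u. u \<in> W \<and> label u = y) else Var y)"

definition rhs_subst :: "('f, 'v) aue set \<Rightarrow> ('f, 'v) subst" where
  "rhs_subst W = (\<lambda>y. if y \<in> labels W then rhs (THE u. u \<in> W \<and> label u = y) else Var y)"

end

theory Submission
  imports Defs
begin

text \<open>Write \<open>W\<close> for the set of all equations of a configuration. Every rule replaces the equations
  \<open>W\<close> by \<open>W'\<close> and composes the substitution with some \<open>\<delta>\<close> such that, on the labels of \<open>W\<close>,
  \<open>\<delta> \<sigma>\<^bsub>W'\<^esub>\<close> agrees with \<open>\<sigma>\<^bsub>W\<^esub>\<close> and \<open>\<delta> \<rho>\<^bsub>W'\<^esub>\<close> agrees with \<open>\<rho>\<^bsub>W\<^esub>\<close> modulo absorption; only the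
  expansion rules need the axioms, through \<open>f(\<epsilon>\<^sub>f, \<star>) \<approx> \<epsilon>\<^sub>f\<close>. Since the variables of \<open>x\<theta>\<close> are
  always labels, \<open>x\<theta>\<sigma>\<^bsub>W\<^esub>\<close> and \<open>x\<theta>\<rho>\<^bsub>W\<^esub>\<close> are invariant modulo absorption along a derivation, and
  initially they are \<open>s\<close> and \<open>t\<close>.\<close>

section \<open>Substitution and equality modulo absorption\<close>

lemma subst_apply_subst_apply: "t \<cdot> \<sigma> \<cdot> \<tau> = t \<cdot> (\<sigma> \<circ>\<^sub>s \<tau>)"
  by (induction t) (auto simp: subst_comp_def)

lemma subst_apply_Var: "t \<cdot> Var = t"
  by (induction t) (auto simp: map_idI)

lemma vars_subst_apply: "vars (t \<cdot> \<sigma>) = (\<Union>x\<in>vars t. vars (\<sigma> x))"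
  by (induction t) auto

lemma wf_trm_subst_apply: "wf_trm ar t \<Longrightarrow> wf_subst ar \<sigma> \<Longrightarrow> wf_trm ar (t \<cdot> \<sigma>)"
  by (induction t) (auto simp: wf_subst_def)

lemma wf_subst_comp: "wf_subst ar \<sigma> \<Longrightarrow> wf_subst ar \<tau> \<Longrightarrow> wf_subst ar (\<sigma> \<circ>\<^sub>s \<tau>)"
  by (metis subst_comp_def wf_subst_def wf_trm_subst_apply)

lemma abs_eq_refl: "wf_trm ar t \<Longrightarrow> abs_eq ar ab t t"
  by (simp add: abs_eq_def eq_theory.refl)

lemma abs_eq_trans: "abs_eq ar ab s t \<Longrightarrow> abs_eq ar ab t u \<Longrightarrow> abs_eq ar ab s u"
  unfolding abs_eq_def by (rule eq_theory.trans)

text \<open>Lets the pointwise agreement provided by one rule be transported below the substitution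
  computed so far. Well-formedness of \<open>t\<close> supplies the arity premise of
  \<open>cong\<close>.\<close>

lemma abs_eq_subst_cong:
  assumes "wf_trm ar t" and "\<And>x. x \<in> vars t \<Longrightarrow> abs_eq ar ab (\<sigma> x) (\<tau> x)"
  shows "abs_eq ar ab (t \<cdot> \<sigma>) (t \<cdot> \<tau>)"
  using assms
proof (induction t)
  case (Fun f ts)
  have "abs_eq ar ab (u \<cdot> \<sigma>) (u \<cdot> \<tau>)" if "u \<in> set ts" for u
    using that Fun by auto
  then have "list_all2 (abs_eq ar ab) (map (\<lambda>u. u \<cdot> \<sigma>) ts) (map (\<lambda>u. u \<cdot> \<tau>) ts)"
    by (auto simp: list_all2_conv_all_nth)
  then show ?case
    using Fun.prems(1) by (auto simp: abs_eq_def intro: eq_theory.cong)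
qed simp

lemma abs_eq_absorb_left:
  assumes "ab f = Some e" and "wf_trm ar t"
  shows "abs_eq ar ab (Fun f [Fun e [], t]) (Fun e [])"
proof -
  have "(Fun f [Fun e [], Var x], Fun e []) \<in> Abs_axioms ab" for x
    using assms(1) by (auto simp: Abs_axioms_def)
  \<comment> \<open>The constant substitution sends the variable of the axiom to \<open>t\<close>,
    whichever variable it is.\<close>
  from eq_theory.ax[OF this, of ar "\<lambda>_. t"] show ?thesis
    using assms(2) by (simp add: abs_eq_def wf_subst_def)
qed

lemma abs_eq_absorb_right:
  assumes "ab f = Some e" and "wf_trm ar t"
  shows "abs_eq ar ab (Fun f [t, Fun e []]) (Fun e [])"
proof -
  have "(Fun f [Var x, Fun e []], Fun e []) \<in> Abs_axioms ab" for x
    using assms(1) by (auto simp: Abs_axioms_def)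
  from eq_theory.ax[OF this, of ar "\<lambda>_. t"] show ?thesis
    using assms(2) by (simp add: abs_eq_def wf_subst_def)
qed

section \<open>Valid sets of equations and their side substitutions\<close>

lemma valid_Un: "valid V \<Longrightarrow> valid W \<Longrightarrow> labels V \<inter> labels W = {} \<Longrightarrow> valid (V \<union> W)"
  unfolding valid_def inj_on_Un by blast

text \<open>Applied to the union of the three components, so that validity also separates the labels
  of different equations from different components.\<close>

definition wf_aues :: "('f \<Rightarrow> nat) \<Rightarrow> ('f, 'v) aue set \<Rightarrow> bool" where
  "wf_aues ar W \<longleftrightarrow> valid W \<and> (\<forall>u\<in>W. wf_trm ar (lhs u) \<and> wf_trm ar (rhs u))"

text \<open>Distinct labels make the definite description in both substitutions pick exactly the
  given equation.\<close>

lemma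
  assumes "wf_aues ar W" and "(s \<triangleq>\<^bsub>x\<^esub> t) \<in> W"
  shows lhs_subst_label: "lhs_subst W x = s"
    and rhs_subst_label: "rhs_subst W x = t"
proof -
  have "(THE u. u \<in> W \<and> label u = x) = (s \<triangleq>\<^bsub>x\<^esub> t)"
    using assms by (intro the_equality) (auto simp: wf_aues_def valid_def inj_on_def)
  moreover have "x \<in> labels W"
    using assms(2) by (metis aue.sel(2) imageI)
  ultimately show "lhs_subst W x = s" "rhs_subst W x = t"
    by (simp_all add: lhs_subst_def rhs_subst_def)
qed

lemma label_cases:
  assumes "x \<in> labels W"
  obtains s t where "(s \<triangleq>\<^bsub>x\<^esub> t) \<in> W"
  using assms by (metis aue.collapse imageE)

lemma
  assumes "wf_aues ar W"
  shows wf_lhs_subst: "wf_subst ar (lhs_subst W)"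
    and wf_rhs_subst: "wf_subst ar (rhs_subst W)"
proof -
  have "wf_trm ar (lhs_subst W x) \<and> wf_trm ar (rhs_subst W x)" for x
  proof (cases "x \<in> labels W")
    case True
    then obtain s t where "(s \<triangleq>\<^bsub>x\<^esub> t) \<in> W"
      by (rule label_cases)
    with assms show ?thesis
      by (force simp: lhs_subst_label rhs_subst_label wf_aues_def)
  qed (simp add: lhs_subst_def rhs_subst_def)
  then show "wf_subst ar (lhs_subst W)" "wf_subst ar (rhs_subst W)"
    by (simp_all add: wf_subst_def)
qed

section \<open>Refinement between sets of equations\<close>

text \<open>The condition on \<open>vars (\<delta> x)\<close> makes refinements composable, since a
  further refinement controls only the labels of \<open>W'\<close>. Including
  \<open>wf_aues ar W'\<close> carries validity and well-formedness along a derivation.\<close>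

definition refines ::
  "('f \<Rightarrow> nat) \<Rightarrow> ('f \<rightharpoonup> 'f) \<Rightarrow> ('f, 'v) aue set \<Rightarrow> ('f, 'v) subst \<Rightarrow> ('f, 'v) aue set \<Rightarrow> bool" where
  "refines ar ab W \<delta> W' \<longleftrightarrow> wf_aues ar W' \<and> wf_subst ar \<delta> \<and>
     (\<forall>s x t. (s \<triangleq>\<^bsub>x\<^esub> t) \<in> W \<longrightarrow> vars (\<delta> x) \<subseteq> labels W' \<and>
        abs_eq ar ab (\<delta> x \<cdot> lhs_subst W') s \<and> abs_eq ar ab (\<delta> x \<cdot> rhs_subst W') t)"

lemma refines_Var:
  assumes "wf_aues ar W"
  shows "refines ar ab W Var W"
  unfolding refines_def
proof (intro conjI allI impI)
  fix s x t
  assume st: "(s \<triangleq>\<^bsub>x\<^esub> t) \<in> W"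
  with assms have wf: "wf_trm ar s" "wf_trm ar t"
    by (force simp: wf_aues_def)+
  show "vars (Var x) \<subseteq> labels W"
    using st by force
  show "abs_eq ar ab (Var x \<cdot> lhs_subst W) s" "abs_eq ar ab (Var x \<cdot> rhs_subst W) t"
    using lhs_subst_label[OF assms st] rhs_subst_label[OF assms st] wf by (simp_all add: abs_eq_refl)
qed (use assms in \<open>simp_all add: wf_subst_def\<close>)

lemma refines_comp:
  assumes "refines ar ab W \<theta> W'" and "refines ar ab W' \<delta> W''"
  shows "refines ar ab W (\<theta> \<circ>\<^sub>s \<delta>) W''"
  unfolding refines_def
proof (intro conjI allI impI)
  show "wf_aues ar W''" "wf_subst ar (\<theta> \<circ>\<^sub>s \<delta>)"
    using assms by (auto simp: refines_def wf_subst_comp)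
  fix s x t
  assume "(s \<triangleq>\<^bsub>x\<^esub> t) \<in> W"
  with assms(1) have sub: "vars (\<theta> x) \<subseteq> labels W'"
    and s: "abs_eq ar ab (\<theta> x \<cdot> lhs_subst W') s" and t: "abs_eq ar ab (\<theta> x \<cdot> rhs_subst W') t"
    and wf: "wf_trm ar (\<theta> x)" and W': "wf_aues ar W'"
    by (auto simp: refines_def wf_subst_def)
  \<comment> \<open>Each variable \<open>z\<close> of \<open>\<theta> x\<close> labels an equation
    of \<open>W'\<close>, whose sides are the values of the two substitutions at \<open>z\<close>;
    hence the second refinement applies to \<open>z\<close>.\<close>
  have *: "vars (\<delta> z) \<subseteq> labels W'' \<and>
      abs_eq ar ab (\<delta> z \<cdot> lhs_subst W'') (lhs_subst W' z) \<and>
      abs_eq ar ab (\<delta> z \<cdot> rhs_subst W'') (rhs_subst W' z)" if z: "z \<in> vars (\<theta> x)" for z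
  proof -
    from z sub obtain s' t' where st': "(s' \<triangleq>\<^bsub>z\<^esub> t') \<in> W'"
      by (meson label_cases subsetD)
    then show ?thesis
      using assms(2) lhs_subst_label[OF W' st'] rhs_subst_label[OF W' st']
      by (auto simp: refines_def)
  qed
  then show "vars ((\<theta> \<circ>\<^sub>s \<delta>) x) \<subseteq> labels W''"
    by (auto simp: subst_comp_def vars_subst_apply)
  have "abs_eq ar ab (\<theta> x \<cdot> (\<delta> \<circ>\<^sub>s lhs_subst W'')) (\<theta> x \<cdot> lhs_subst W')"
    using wf * by (intro abs_eq_subst_cong) (auto simp: subst_comp_def)
  with s show "abs_eq ar ab ((\<theta> \<circ>\<^sub>s \<delta>) x \<cdot> lhs_subst W'') s"
    by (metis abs_eq_trans subst_apply_subst_apply subst_comp_def)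
  have "abs_eq ar ab (\<theta> x \<cdot> (\<delta> \<circ>\<^sub>s rhs_subst W'')) (\<theta> x \<cdot> rhs_subst W')"
    using wf * by (intro abs_eq_subst_cong) (auto simp: subst_comp_def)
  with t show "abs_eq ar ab ((\<theta> \<circ>\<^sub>s \<delta>) x \<cdot> rhs_subst W'') t"
    by (metis abs_eq_trans subst_apply_subst_apply subst_comp_def)
qed

text \<open>Replacing the equation labelled \<open>x\<close> leaves the others alone: the labels of
  \<open>V\<close> differ from \<open>x\<close>, so the substitution fixes them, and
  \<open>V \<subseteq> W'\<close> reduces them to \<open>refines_Var\<close>. This serves
  \<open>Mer\<close> as well as the rules with fresh labels.\<close>

lemma refines_single:
  assumes "wf_aues ar W'" and "V \<subseteq> W'" and "x \<notin> labels V"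
    and "wf_trm ar r" and "vars r \<subseteq> labels W'"
    and "abs_eq ar ab (r \<cdot> lhs_subst W') s" and "abs_eq ar ab (r \<cdot> rhs_subst W') t"
  shows "refines ar ab (insert (s \<triangleq>\<^bsub>x\<^esub> t) V) (Var(x := r)) W'"
  unfolding refines_def
proof (intro conjI allI impI)
  show "wf_subst ar (Var(x := r))"
    using assms(4) by (simp add: wf_subst_def)
  fix s' z t'
  assume "(s' \<triangleq>\<^bsub>z\<^esub> t') \<in> insert (s \<triangleq>\<^bsub>x\<^esub> t) V"
  then consider "s' = s" "z = x" "t' = t" | "(s' \<triangleq>\<^bsub>z\<^esub> t') \<in> V" "z \<noteq> x"
    using assms(3) by force
  then have "vars ((Var(x := r)) z) \<subseteq> labels W' \<and>
    abs_eq ar ab ((Var(x := r)) z \<cdot> lhs_subst W') s' \<and>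
    abs_eq ar ab ((Var(x := r)) z \<cdot> rhs_subst W') t'"
  proof cases
    case 2
    then show ?thesis
      using refines_Var[OF assms(1), of ab] assms(2) by (auto simp: refines_def)
  qed (use assms in auto)
  then show "vars ((Var(x := r)) z) \<subseteq> labels W'"
    "abs_eq ar ab ((Var(x := r)) z \<cdot> lhs_subst W') s'"
    "abs_eq ar ab ((Var(x := r)) z \<cdot> rhs_subst W') t'"
    by auto
qed (use assms in simp)

text \<open>The common shape of \<open>Dec\<close> and the expansion rules.\<close>

lemma refines_expand:
  fixes ss' ts' :: "('f, 'v) trm list"
  assumes wf: "wf_aues ar (insert (s \<triangleq>\<^bsub>x\<^esub> t) V)" and "(s \<triangleq>\<^bsub>x\<^esub> t) \<notin> V"
    and len: "length ss' = length ys" "length ts' = length ys" "ar f = length ys"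
    and wf_args: "\<forall>u\<in>set ss' \<union> set ts'. wf_trm ar u"
    and fresh: "distinct ys" "set ys \<inter> labels V = {}"
    and s: "abs_eq ar ab (Fun f ss') s" and t: "abs_eq ar ab (Fun f ts') t"
    and W': "W' = {(ss' ! i \<triangleq>\<^bsub>ys ! i\<^esub> ts' ! i) | i. i < length ys} \<union> V"
  shows "refines ar ab (insert (s \<triangleq>\<^bsub>x\<^esub> t) V) (Var(x := Fun f (map Var ys))) W'"
proof (rule refines_single)
  let ?N = "{(ss' ! i \<triangleq>\<^bsub>ys ! i\<^esub> ts' ! i) | i. i < length ys}"
  \<comment> \<open>Old labels are distinct by assumption, new ones as distinct entries of
    \<open>ys\<close>, and freshness keeps the two groups apart.\<close>
  have "inj_on label V"
    using wf by (auto simp: wf_aues_def valid_def)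
  moreover have "inj_on label ?N"
    using fresh(1) by (auto simp: inj_on_def nth_eq_iff_index_eq)
  moreover have "labels ?N \<subseteq> set ys"
    by auto
  ultimately have "valid W'"
    using fresh(2) unfolding W' by (intro valid_Un) (auto simp: valid_def)
  then show wfW': "wf_aues ar W'"
    using wf wf_args len unfolding wf_aues_def W' by auto
  show "V \<subseteq> W'"
    by (simp add: W')
  show "x \<notin> labels V"
    using wf assms(2) by (auto simp: wf_aues_def valid_def)
  show "wf_trm ar (Fun f (map Var ys))"
    using len by simp
  have N: "(ss' ! i \<triangleq>\<^bsub>ys ! i\<^esub> ts' ! i) \<in> W'" if "i < length ys" for i
    using that W' by blast
  show "vars (Fun f (map Var ys)) \<subseteq> labels W'"
  proof
    fix y
    assume "y \<in> vars (Fun f (map Var ys))"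
    then obtain i where "i < length ys" "y = ys ! i"
      by (auto simp: in_set_conv_nth)
    with N show "y \<in> labels W'"
      by (metis aue.sel(2) imageI)
  qed
  \<comment> \<open>Reading off the sides at the labels \<open>ys\<close> recovers the argument
    lists, so the new term instantiates to \<open>Fun f ss'\<close> and
    \<open>Fun f ts'\<close>.\<close>
  have "map (lhs_subst W') ys = ss'" "map (rhs_subst W') ys = ts'"
    using len by (auto intro!: nth_equalityI simp: lhs_subst_label[OF wfW' N] rhs_subst_label[OF wfW' N])
  then show "abs_eq ar ab (Fun f (map Var ys) \<cdot> lhs_subst W') s"
    "abs_eq ar ab (Fun f (map Var ys) \<cdot> rhs_subst W') t"
    using s t by (simp_all add: comp_def)
qed

text \<open>Brings the indexed family of \<open>refines_expand\<close> into the form in which the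
  expansion rules add their two equations.\<close>

lemma two_aues:
  "{([s1, s2] ! i \<triangleq>\<^bsub>[y1, y2] ! i\<^esub> [t1, t2] ! i) | i. i < length [y1, y2]} =
    {s1 \<triangleq>\<^bsub>y1\<^esub> t1, s2 \<triangleq>\<^bsub>y2\<^esub> t2}"
  by (auto simp: less_Suc_eq exI[of _ "0::nat"] exI[of _ "Suc 0"])

section \<open>Rule applications as refinements\<close>

fun aues :: "('f, 'v) config \<Rightarrow> ('f, 'v) aue set" where
  "aues (A, S, T, \<theta>) = A \<union> S \<union> T"

fun config_subst :: "('f, 'v) config \<Rightarrow> ('f, 'v) subst" where
  "config_subst (A, S, T, \<theta>) = \<theta>"

text \<open>Validity of the union alone would allow one equation to lie in two components, and a step on
  one copy would then remove its label from the range of the substitution but not from the other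
  component.\<close>

fun disjoint_config :: "('f, 'v) config \<Rightarrow> bool" where
  "disjoint_config (A, S, T, \<theta>) \<longleftrightarrow> A \<inter> S = {} \<and> A \<inter> T = {} \<and> S \<inter> T = {}"

lemma not_label_not_aue: "y \<notin> labels W \<Longrightarrow> (s \<triangleq>\<^bsub>y\<^esub> t) \<notin> W"
  by force

lemma fresh_labels:
  assumes "fresh ys (insert u A, S, T, \<theta>)"
  shows "distinct ys \<and> set ys \<inter> labels (A \<union> S \<union> T) = {}"
  using assms by (simp_all add: fresh_def Int_Un_distrib image_Un)

text \<open>New equations carry fresh labels, so they cannot coincide with equations of the other
  components; \<open>Sol\<close> and \<open>Mer\<close> only move or delete an equation.\<close>

lemma step_disjoint_config:
  assumes "step ab star c c'" and "disjoint_config c"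
  shows "disjoint_config c'"
  using assms
proof cases
  case (Dec f ss x ts A n ys S T \<theta>)
  have "set ys \<inter> labels (A \<union> S \<union> T) = {}"
    using fresh_labels[OF Dec(7)] ..
  then have "ys ! i \<notin> labels S" "ys ! i \<notin> labels T" if "i < n" for i
    using that Dec(6) nth_mem[of i ys] unfolding image_Un by blast+
  then show ?thesis
    using assms(2) Dec(1,2) by (auto simp: not_label_not_aue)
qed (use assms(2) in \<open>auto dest!: fresh_labels simp: image_Un not_label_not_aue\<close>)

lemma step_refines:
  assumes "absorption_theory ar ab" and "ar star = 0"
    and "step ab star c c'" and "disjoint_config c" and "wf_aues ar (aues c)"
  shows "\<exists>\<delta>. config_subst c' = config_subst c \<circ>\<^sub>s \<delta> \<and> refines ar ab (aues c) \<delta> (aues c')"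
proof -
  \<comment> \<open>Shared by \<open>Dec\<close> and the four expansion rules, which supply
    \<open>ss'\<close> and \<open>ts'\<close> such that \<open>Fun f ss'\<close> and
    \<open>Fun f ts'\<close> equal the old sides modulo absorption.\<close>
  have expand: "\<exists>\<delta>. config_subst c' = config_subst c \<circ>\<^sub>s \<delta> \<and> refines ar ab (aues c) \<delta> (aues c')"
    if "c = (insert (s \<triangleq>\<^bsub>x\<^esub> t) A, S, T, \<theta>)" "(s \<triangleq>\<^bsub>x\<^esub> t) \<notin> A"
      "config_subst c' = \<theta> \<circ>\<^sub>s Var(x := Fun f (map Var ys))"
      "aues c' = {(ss' ! i \<triangleq>\<^bsub>ys ! i\<^esub> ts' ! i) | i. i < length ys} \<union> (A \<union> S \<union> T)"
      "fresh ys c" "length ss' = length ys" "length ts' = length ys" "ar f = length ys"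
      "\<forall>u\<in>set ss' \<union> set ts'. wf_trm ar u"
      "abs_eq ar ab (Fun f ss') s" "abs_eq ar ab (Fun f ts') t"
    for s x t A S T \<theta> f ys ss' ts'
  proof -
    have "refines ar ab (insert (s \<triangleq>\<^bsub>x\<^esub> t) (A \<union> S \<union> T)) (Var(x := Fun f (map Var ys))) (aues c')"
    proof (rule refines_expand)
      \<comment> \<open>The rule excludes \<open>A\<close>, disjointness excludes \<open>S\<close>
        and \<open>T\<close>; otherwise \<open>x\<close> would remain a label after the
        step.\<close>
      show "(s \<triangleq>\<^bsub>x\<^esub> t) \<notin> A \<union> S \<union> T"
        using that(1,2) assms(4) by auto
      show "distinct ys" "set ys \<inter> labels (A \<union> S \<union> T) = {}"
        using fresh_labels that(1,5) by blast+
    qed (use that assms(5) in simp_all)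
    then show ?thesis
      using that(1,3) by auto
  qed
  from assms(1) have ar: "ar f = 2" "ar e = 0" if "ab f = Some e" for f e
    using that by (auto simp: absorption_theory_def)
  from assms(3) show ?thesis
  proof cases
    case (Dec f ss x ts A n ys S T \<theta>)
    then have "wf_trm ar (Fun f ss)" "wf_trm ar (Fun f ts)"
      using assms(5) by (auto simp: wf_aues_def)
    with Dec show ?thesis
      by (intro expand[where ss' = ss and ts' = ts and ys = ys and f = f])
        (auto simp: abs_eq_refl)
  next
    case (Sol s x t A S T \<theta>)
    \<comment> \<open>The equation only changes its component, so the union is unchanged and
      \<open>Var\<close> is the refinement.\<close>
    have "config_subst c' = config_subst c \<circ>\<^sub>s Var"
      using Sol by (auto simp: subst_comp_def intro!: ext subst_apply_Var[symmetric])
    moreover have "aues c' = aues c"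
      using Sol by auto
    ultimately show ?thesis
      using refines_Var assms(5) by metis
  next
    case (ExpLA1 e x f t1 t2 A y1 y2 S T \<theta>)
    then have "wf_trm ar (Fun f [t1, t2])"
      using assms(5) by (auto simp: wf_aues_def)
    \<comment> \<open>The left side \<open>Fun e []\<close> is expanded backwards to
      \<open>Fun f [Fun e [], Fun star []]\<close>, with the wild card as the absorbed argument. The
      other expansion rules differ in the side expanded and the position of the wild card.\<close>
    with ExpLA1 ar[OF ExpLA1(4)] assms(2) show ?thesis
      by (intro expand[where ss' = "[Fun e [], Fun star []]" and ts' = "[t1, t2]"
            and ys = "[y1, y2]" and f = f, unfolded two_aues])
        (auto simp: abs_eq_refl abs_eq_absorb_left)
  next
    case (ExpLA2 e x f t1 t2 A y1 y2 S T \<theta>)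
    then have "wf_trm ar (Fun f [t1, t2])"
      using assms(5) by (auto simp: wf_aues_def)
    with ExpLA2 ar[OF ExpLA2(4)] assms(2) show ?thesis
      by (intro expand[where ss' = "[Fun star [], Fun e []]" and ts' = "[t1, t2]"
            and ys = "[y1, y2]" and f = f, unfolded two_aues])
        (auto simp: abs_eq_refl abs_eq_absorb_right)
  next
    case (ExpRA1 f s1 s2 x e A y1 y2 S T \<theta>)
    then have "wf_trm ar (Fun f [s1, s2])"
      using assms(5) by (auto simp: wf_aues_def)
    with ExpRA1 ar[OF ExpRA1(4)] assms(2) show ?thesis
      by (intro expand[where ss' = "[s1, s2]" and ts' = "[Fun e [], Fun star []]"
            and ys = "[y1, y2]" and f = f, unfolded two_aues])
        (auto simp: abs_eq_refl abs_eq_absorb_left)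
  next
    case (ExpRA2 f s1 s2 x e A y1 y2 S T \<theta>)
    then have "wf_trm ar (Fun f [s1, s2])"
      using assms(5) by (auto simp: wf_aues_def)
    with ExpRA2 ar[OF ExpRA2(4)] assms(2) show ?thesis
      by (intro expand[where ss' = "[s1, s2]" and ts' = "[Fun star [], Fun e []]"
            and ys = "[y1, y2]" and f = f, unfolded two_aues])
        (auto simp: abs_eq_refl abs_eq_absorb_right)
  next
    case (Mer x y s t S T \<theta>)
    let ?V = "insert (s \<triangleq>\<^bsub>y\<^esub> t) (S \<union> T)"
    have c: "aues c = insert (s \<triangleq>\<^bsub>x\<^esub> t) ?V" and c': "aues c' = ?V"
      using Mer by auto
    have V: "wf_aues ar ?V"
      using assms(5) unfolding c by (auto simp: wf_aues_def valid_def)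
    have y: "(s \<triangleq>\<^bsub>y\<^esub> t) \<in> ?V"
      by simp
    \<comment> \<open>The side conditions of \<open>Mer\<close> separate the deleted equation from
      the kept one and from \<open>S\<close>; disjointness keeps it out of \<open>T\<close>.
      Validity then frees the label \<open>x\<close>.\<close>
    have "(s \<triangleq>\<^bsub>x\<^esub> t) \<notin> ?V"
      using Mer assms(4) by auto
    then have "x \<notin> labels ?V"
      using assms(5) unfolding c wf_aues_def valid_def by simp
    moreover have "wf_trm ar s" "wf_trm ar t"
      using assms(5) unfolding c wf_aues_def by auto
    \<comment> \<open>The surviving label \<open>y\<close> has the same two sides, so redirecting
      \<open>x\<close> to it changes neither instance.\<close>
    ultimately have "refines ar ab (aues c) (Var(x := Var y)) (aues c')"
      unfolding c c' using V
      by (intro refines_single)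
        (auto simp: lhs_subst_label[OF V y] rhs_subst_label[OF V y] abs_eq_refl)
    then show ?thesis
      using Mer by auto
  qed
qed

section \<open>Derivations\<close>

text \<open>The factor \<open>\<delta>\<close> accumulated since the start is tracked apart from the
  initial substitution, because it alone acts on the initial labels.\<close>

lemma derivation_refines:
  assumes "absorption_theory ar ab" and "ar star = 0"
    and "(step ab star)\<^sup>*\<^sup>* c c'" and "disjoint_config c" and "wf_aues ar (aues c)"
  shows "\<exists>\<delta>. config_subst c' = config_subst c \<circ>\<^sub>s \<delta> \<and> refines ar ab (aues c) \<delta> (aues c')"
proof -
  from assms(3) have "disjoint_config c' \<and>
    (\<exists>\<delta>. config_subst c' = config_subst c \<circ>\<^sub>s \<delta> \<and> refines ar ab (aues c) \<delta> (aues c'))"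
  proof (induction rule: rtranclp_induct)
    case base
    have "config_subst c = config_subst c \<circ>\<^sub>s Var"
      by (simp add: subst_comp_def subst_apply_Var)
    then show ?case
      using assms(4,5) refines_Var by blast
  next
    case (step c' c'')
    then obtain \<delta> where \<delta>: "config_subst c' = config_subst c \<circ>\<^sub>s \<delta>"
      "refines ar ab (aues c) \<delta> (aues c')"
      by blast
    moreover have "wf_aues ar (aues c')"
      using \<delta>(2) by (simp add: refines_def)
    with step obtain \<delta>' where "config_subst c'' = config_subst c' \<circ>\<^sub>s \<delta>'"
      "refines ar ab (aues c') \<delta>' (aues c'')"
      using step_refines[OF assms(1,2)] by blast
    moreover have "config_subst c \<circ>\<^sub>s \<delta> \<circ>\<^sub>s \<delta>' = config_subst c \<circ>\<^sub>s (\<delta> \<circ>\<^sub>s \<delta>')"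
      by (simp add: subst_comp_def subst_apply_subst_apply)
    ultimately have "config_subst c'' = config_subst c \<circ>\<^sub>s (\<delta> \<circ>\<^sub>s \<delta>')"
      "refines ar ab (aues c) (\<delta> \<circ>\<^sub>s \<delta>') (aues c'')"
      by (auto intro: refines_comp)
    moreover have "disjoint_config c''"
      using step_disjoint_config[OF step.hyps(2)] step.IH by simp
    ultimately show ?case
      by blast
  qed
  then show ?thesis ..
qed

theorem theorem2:
  fixes ar :: "'f \<Rightarrow> nat"
    and ab :: "'f \<rightharpoonup> 'f"
    and star :: 'f
    and A\<^sub>0 S\<^sub>0 T\<^sub>0 S\<^sub>n T\<^sub>n :: "('f, 'v) aue set"
    and \<theta>\<^sub>0 \<theta>\<^sub>n :: "('f, 'v) subst"
  assumes "absorption_theory ar ab"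
    and "ar star = 0"
    and "derivation ar ab star (A\<^sub>0, S\<^sub>0, T\<^sub>0, \<theta>\<^sub>0) ({}, S\<^sub>n, T\<^sub>n, \<theta>\<^sub>n)"
    and "final ab star ({}, S\<^sub>n, T\<^sub>n, \<theta>\<^sub>n)"
  shows "\<forall>s x t. (s \<triangleq>\<^bsub>x\<^esub> t) \<in> A\<^sub>0 \<union> S\<^sub>0 \<union> T\<^sub>0 \<longrightarrow>
    Var x \<cdot> \<theta>\<^sub>n \<in> generalizations ar ab s t \<and>
    abs_eq ar ab (Var x \<cdot> \<theta>\<^sub>n \<cdot> lhs_subst (S\<^sub>n \<union> T\<^sub>n)) s \<and>
    abs_eq ar ab (Var x \<cdot> \<theta>\<^sub>n \<cdot> rhs_subst (S\<^sub>n \<union> T\<^sub>n)) t"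
proof (intro allI impI)
  fix s x t
  assume st: "(s \<triangleq>\<^bsub>x\<^esub> t) \<in> A\<^sub>0 \<union> S\<^sub>0 \<union> T\<^sub>0"
  have conf: "configuration ar ab star (A\<^sub>0, S\<^sub>0, T\<^sub>0, \<theta>\<^sub>0)"
    and steps: "(step ab star)\<^sup>*\<^sup>* (A\<^sub>0, S\<^sub>0, T\<^sub>0, \<theta>\<^sub>0) ({}, S\<^sub>n, T\<^sub>n, \<theta>\<^sub>n)"
    using assms(3) by (auto simp: derivation_def)
  have "disjoint_config (A\<^sub>0, S\<^sub>0, T\<^sub>0, \<theta>\<^sub>0)"
    using conf by auto
  moreover have "valid (A\<^sub>0 \<union> S\<^sub>0 \<union> T\<^sub>0)"
    using conf by (auto intro!: valid_Un simp: image_Un Int_Un_distrib2)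
  then have "wf_aues ar (aues (A\<^sub>0, S\<^sub>0, T\<^sub>0, \<theta>\<^sub>0))"
    using conf by (auto simp: wf_aues_def)
  ultimately obtain \<delta> where \<theta>n: "\<theta>\<^sub>n = \<theta>\<^sub>0 \<circ>\<^sub>s \<delta>"
    and ref: "refines ar ab (A\<^sub>0 \<union> S\<^sub>0 \<union> T\<^sub>0) \<delta> (S\<^sub>n \<union> T\<^sub>n)"
    using derivation_refines[OF assms(1,2) steps] by auto
  \<comment> \<open>Labels of a configuration lie outside \<open>Dom \<theta>\<^sub>0\<close>, so
    \<open>\<theta>\<^sub>0\<close> fixes \<open>x\<close> and the final value is
    \<open>\<delta> x\<close>.\<close>
  have "x \<notin> Dom \<theta>\<^sub>0"
    using conf st by force
  then have x: "\<theta>\<^sub>n x = \<delta> x"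
    by (simp add: \<theta>n Dom_def subst_comp_def)
  have "abs_eq ar ab (\<theta>\<^sub>n x \<cdot> lhs_subst (S\<^sub>n \<union> T\<^sub>n)) s"
    "abs_eq ar ab (\<theta>\<^sub>n x \<cdot> rhs_subst (S\<^sub>n \<union> T\<^sub>n)) t"
    using ref st by (auto simp: refines_def x)
  \<comment> \<open>Well-formed final equations make the two side substitutions admissible witnesses
    for \<open>more_general\<close>.\<close>
  moreover have "wf_trm ar (\<theta>\<^sub>n x)" "wf_aues ar (S\<^sub>n \<union> T\<^sub>n)"
    using ref by (simp_all add: refines_def wf_subst_def x)
  ultimately show "Var x \<cdot> \<theta>\<^sub>n \<in> generalizations ar ab s t \<and>
    abs_eq ar ab (Var x \<cdot> \<theta>\<^sub>n \<cdot> lhs_subst (S\<^sub>n \<union> T\<^sub>n)) s \<and>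
    abs_eq ar ab (Var x \<cdot> \<theta>\<^sub>n \<cdot> rhs_subst (S\<^sub>n \<union> T\<^sub>n)) t"
    using wf_lhs_subst wf_rhs_subst unfolding generalizations_def more_general_def by fastforce
qed

end
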